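(* Let $p$ be an odd prime, $q=p^s$ with $s\ge 1$, and $\mathbb{A}=\mathbb{F}_q[X]$. Then for every polynomial $f\in\mathbb{A}$ with $\deg f\ge 1$, $$G(f)\equiv\begin{cases}-1 \pmod f & \text{if } f \text{ has only one prime divisor},\\ 1 \pmod f & \text{otherwise}.\end{cases}$$
   Context: For $f\in\mathbb{A}$ with $\deg f\ge 1$, the Gauss factorial is $G(f)=\prod g$, the product over all non-zero $g\in\mathbb{A}$ with $0\le \deg g<\deg f$ and $\gcd(g,f)=1$. A prime divisor of $f$ is a monic irreducible polynomial dividing $f$. *)

theory Defs
  imports
    "HOL-Library.Cardinality"
    "HOL-Computational_Algebra.Polynomial"
    "HOL-Number_Theory.Cong"
begin

(* The condition g \<noteq> 0 is the "0 \<le> deg g" of the Gauss factorial: the library sets degree 0 = 0,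
   so the zero polynomial would otherwise pass the degree bound (and it is coprime to constants).
   coprime g f says gcd(g, f) = 1 without choosing a normalised gcd on the coefficient field. *)
definition gauss_factorial_support :: "'a :: field poly \<Rightarrow> 'a poly set" where
  "gauss_factorial_support f = {g. g \<noteq> 0 \<and> degree g < degree f \<and> coprime g f}"

definition gauss_factorial :: "'a :: field poly \<Rightarrow> 'a poly" where
  "gauss_factorial f = (\<Prod>g\<in>gauss_factorial_support f. g)"

definition prime_divisor :: "'a :: field poly \<Rightarrow> 'a poly \<Rightarrow> bool" where
  "prime_divisor P f \<longleftrightarrow> lead_coeff P = 1 \<and> irreducible P \<and> P dvd f"

(* Hence the product above is a genuine finite product over a finite coefficient field
   (the library's product over an infinite set would be 1). *)
lemma finite_gauss_factorial_support:
  fixes f :: "'a :: {field, finite} poly"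
  shows "finite (gauss_factorial_support f)"
proof -
  have "gauss_factorial_support f \<subseteq> Poly ` {xs. set xs \<subseteq> UNIV \<and> length xs \<le> degree f}"
  proof
    fix g assume "g \<in> gauss_factorial_support f"
    then have "length (coeffs g) \<le> degree f"
      by (auto simp: gauss_factorial_support_def length_coeffs_degree)
    then show "g \<in> Poly ` {xs. set xs \<subseteq> UNIV \<and> length xs \<le> degree f}"
      by (intro image_eqI[where x = "coeffs g"]) auto
  qed
  then show ?thesis
    by (rule finite_subset) (intro finite_imageI finite_lists_length_le finite)
qed

end

theory Submission
  imports "HOL-Number_Theory.Residues" Defs "HOL-Computational_Algebra.Polynomial_Factorial"
begin

text \<open>
  Pairing each unit modulo \<open>f\<close> with its inverse leaves the product of the \<open>g\<close> with \<open>g\<^sup>2 = 1\<close>.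
  Since \<open>2\<close> is invertible, \<open>g - 1\<close> and \<open>g + 1\<close> share no prime divisor, so if \<open>f\<close> has only one
  prime divisor, then \<open>g\<close> is \<open>1\<close> or \<open>- 1\<close>. For any \<open>c \<noteq> 1\<close> with \<open>c\<^sup>2 = 1\<close>, pairing \<open>g\<close> with \<open>c g\<close>
  shows that the product is \<open>c\<^sup>k\<close>, where \<open>2 k\<close> is the number of such \<open>g\<close>. If \<open>f\<close> has two prime
  divisors, there is such a \<open>c\<close> other than \<open>- 1\<close>; comparing \<open>c\<^sup>k\<close> with \<open>(- 1)\<^sup>k\<close> shows that \<open>k\<close> is
  even.
\<close>

section \<open>Bezout identities and inverses modulo an element\<close>

text \<open>The Euclidean algorithm: a combination for \<open>b\<close> and \<open>a mod b\<close>
  becomes one for \<open>a\<close> and \<open>b\<close> after substituting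
  \<open>a mod b = a - (a div b) * b\<close>. Divisibility stands in for a chosen gcd.\<close>

lemma bezout_euclidean_ring:
  fixes a b :: "'a :: euclidean_ring"
  shows "\<exists>x y. a * x + b * y dvd a \<and> a * x + b * y dvd b"
proof (induction "euclidean_size b" arbitrary: a b rule: less_induct)
  case less
  show ?case
  proof (cases "b = 0")
    case True
    then show ?thesis by (intro exI[of _ 1] exI[of _ 0]) simp
  next
    case False
    then obtain x y where d: "b * x + (a mod b) * y dvd b" "b * x + (a mod b) * y dvd a mod b"
      using less[of "a mod b" b] mod_size_less by blast
    then have "b * x + (a mod b) * y dvd a"
      using dvd_mod_imp_dvd by blast
    moreover have "b * x + (a mod b) * y = a * y + b * (x - (a div b) * y)"
      by (simp add: algebra_simps minus_mult_div_eq_mod[symmetric])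
    ultimately show ?thesis using d by metis
  qed
qed

lemma coprime_imp_bezout:
  fixes a b :: "'a :: euclidean_ring"
  assumes "coprime a b"
  obtains x y where "a * x + b * y = 1"
proof -
  obtain x y where "a * x + b * y dvd a" "a * x + b * y dvd b"
    using bezout_euclidean_ring by blast
  with assms have "a * x + b * y dvd 1"
    by (rule coprime_common_divisor)
  then obtain z where "1 = (a * x + b * y) * z" ..
  then have "a * (x * z) + b * (y * z) = 1"
    by (simp add: algebra_simps)
  then show ?thesis by (rule that)
qed

text \<open>A Bezout coefficient of \<open>a\<close> is an inverse modulo \<open>m\<close>;
  conversely, a common divisor of \<open>a\<close> and \<open>m\<close> divides both
  \<open>a * x\<close> and \<open>a * x - 1\<close>.\<close>

lemma coprime_iff_cong_inverse:
  fixes a m :: "'a :: unique_euclidean_ring"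
  shows "coprime a m \<longleftrightarrow> (\<exists>x. [a * x = 1] (mod m))"
proof
  assume "coprime a m"
  then obtain x y where "a * x + m * y = 1" by (rule coprime_imp_bezout)
  then have "a * x - 1 = m * (- y)" by (simp add: algebra_simps eq_neg_iff_add_eq_0)
  then show "\<exists>x. [a * x = 1] (mod m)"
    by (metis cong_iff_dvd_diff dvd_triv_left)
next
  assume "\<exists>x. [a * x = 1] (mod m)"
  then obtain x where x: "m dvd a * x - 1" by (auto simp: cong_iff_dvd_diff)
  show "coprime a m"
  proof (rule coprimeI)
    fix c assume "c dvd a" "c dvd m"
    then have "c dvd a * x" "c dvd a * x - 1" using x by (auto intro: dvd_trans)
    then have "c dvd a * x - (a * x - 1)" by (rule dvd_diff)
    then show "c dvd 1" by simp
  qed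
qed

lemma coprime_dvd_multD:
  fixes a b c :: "'a :: euclidean_ring"
  assumes "coprime b a" "a dvd b * c"
  shows "a dvd c"
proof -
  obtain x y where xy: "b * x + a * y = 1" using coprime_imp_bezout[OF assms(1)] .
  have "c = (b * x + a * y) * c" by (simp add: xy)
  also have "\<dots> = b * c * x + a * (y * c)" by (simp add: algebra_simps)
  also have "a dvd \<dots>" using assms(2) by auto
  finally show ?thesis .
qed

section \<open>Products over sets that split into pairs\<close>

text \<open>Removing \<open>x\<close> and its partner takes away a factor congruent to
  \<open>c\<close> and two distinct elements. Keeping \<open>c\<close> general covers both the
  pairing of units with their inverses (\<open>c = 1\<close>) and that of the square roots of
  1.\<close>

lemma cong_prod_pairing:
  fixes m c :: "'a :: unique_euclidean_semiring"
  assumes "finite A"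
    and "\<And>x. x \<in> A \<Longrightarrow> \<not> [x * x = c] (mod m)"
    and "\<And>x. x \<in> A \<Longrightarrow> \<exists>!y. y \<in> A \<and> [x * y = c] (mod m)"
  shows "[\<Prod>A = c ^ (card A div 2)] (mod m)"
  using assms
proof (induction "card A" arbitrary: A rule: less_induct)
  case less
  show ?case
  proof (cases "A = {}")
    case False
    then obtain x y where xy: "x \<in> A" "y \<in> A" "[x * y = c] (mod m)"
      using less.prems(3) by blast
    then have "x \<noteq> y" using less.prems(2) by auto
    define B where "B = A - {x, y}"
    have B: "finite B" "x \<notin> B" "y \<notin> B" "A = insert x (insert y B)"
      using less.prems(1) xy by (auto simp: B_def)
    have card: "card A = Suc (Suc (card B))"
      using B \<open>x \<noteq> y\<close> by simp
    have "[\<Prod>B = c ^ (card B div 2)] (mod m)"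
    proof (rule less.hyps)
      show "\<exists>!w. w \<in> B \<and> [z * w = c] (mod m)" if z: "z \<in> B" for z
      proof -
        obtain w where w: "w \<in> A" "[z * w = c] (mod m)"
          using z less.prems(3)[of z] by (auto simp: B_def)
        have uniq: "\<And>u v v'. u \<in> A \<Longrightarrow> v \<in> A \<Longrightarrow> v' \<in> A \<Longrightarrow> [u * v = c] (mod m)
            \<Longrightarrow> [u * v' = c] (mod m) \<Longrightarrow> v = v'"
          using less.prems(3) by blast
        have "z \<in> A" "z \<noteq> x" "z \<noteq> y" using z by (auto simp: B_def)
        \<comment> \<open>The partner of \<open>x\<close> is \<open>y\<close> and that of
          \<open>y\<close> is \<open>x\<close>, so \<open>z\<close>, being neither, has its partner
          outside the removed pair.\<close>
        then have "w \<noteq> x" "w \<noteq> y"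
          using uniq[of x z y] uniq[of y z x] xy w by (auto simp: mult.commute)
        then have "w \<in> B" using w by (simp add: B_def)
        then show ?thesis using w uniq \<open>z \<in> A\<close> B(4) by blast
      qed
    qed (use card B(1) less.prems(2) in \<open>auto simp: B_def\<close>)
    then have "[x * y * \<Prod>B = c * c ^ (card B div 2)] (mod m)"
      using xy(3) by (rule cong_mult[rotated])
    then show ?thesis
      using B \<open>x \<noteq> y\<close> card by (simp add: mult.assoc)
  qed simp
qed

section \<open>Prime divisors and coprime factors of polynomials\<close>

text \<open>Descent on the degree: a reducible \<open>f\<close> has a non-unit factor of smaller
  degree. Dividing by the leading coefficient makes the irreducible divisor monic.\<close>

lemma monic_irreducible_divisor_exists:
  fixes f :: "'a :: field poly"
  assumes "f \<noteq> 0" "\<not> f dvd 1"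
  obtains P where "prime_divisor P f"
proof -
  have "\<exists>P. irreducible P \<and> P dvd f"
    using assms
  proof (induction "degree f" arbitrary: f rule: less_induct)
    case less
    show ?case
    proof (cases "irreducible f")
      case False
      then obtain a b where ab: "f = a * b" "\<not> a dvd 1" "\<not> b dvd 1"
        using less.prems by (auto simp: irreducible_def)
      then have "a \<noteq> 0" "b \<noteq> 0" using less.prems by auto
      then have "degree a < degree f"
        using ab by (auto simp: degree_mult_eq is_unit_iff_degree)
      then obtain P where "irreducible P" "P dvd a"
        using less.hyps ab \<open>a \<noteq> 0\<close> by blast
      then show ?thesis using ab by auto
    qed auto
  qed
  then obtain P where P: "irreducible P" "P dvd f" by blast
  then have "P \<noteq> 0" by auto
  define Q where "Q = smult (inverse (lead_coeff P)) P"
  have "P = smult (lead_coeff P) Q" using \<open>P \<noteq> 0\<close> by (simp add: Q_def)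
  have "prime_divisor Q f"
    unfolding prime_divisor_def
  proof (intro conjI)
    show "irreducible Q"
    proof -
      have "[:inverse (lead_coeff P):] dvd 1"
        using \<open>P \<noteq> 0\<close> by (simp add: is_unit_const_poly_iff dvd_field_iff)
      moreover have "Q = [:inverse (lead_coeff P):] * P" by (simp add: Q_def)
      ultimately show ?thesis using P(1) by (metis irreducible_mult_unit_left)
    qed
    show "Q dvd f" using P \<open>P \<noteq> 0\<close> by (simp add: Q_def smult_dvd)
    show "lead_coeff Q = 1" using \<open>P \<noteq> 0\<close> by (simp add: Q_def)
  qed
  then show ?thesis by (rule that)
qed

lemma coprime_polyI:
  fixes f g :: "'a :: field poly"
  assumes "f \<noteq> 0" and "\<And>P. prime_divisor P f \<Longrightarrow> prime_divisor P g \<Longrightarrow> False"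
  shows "coprime f g"
proof (rule coprimeI)
  fix c assume c: "c dvd f" "c dvd g"
  show "c dvd 1"
  proof (rule ccontr)
    assume "\<not> c dvd 1"
    moreover have "c \<noteq> 0" using c \<open>f \<noteq> 0\<close> by auto
    ultimately obtain P where "prime_divisor P c"
      using monic_irreducible_divisor_exists by blast
    then have "prime_divisor P f" "prime_divisor P g"
      using c by (auto simp: prime_divisor_def intro: dvd_trans)
    then show False by (rule assms(2))
  qed
qed

text \<open>Irreducibility makes \<open>P\<close> and \<open>Q\<close> associated, and a constant
  quotient of two monic polynomials is 1.\<close>

lemma prime_divisor_dvd_eq:
  fixes P Q :: "'a :: field poly"
  assumes P: "prime_divisor P f" and Q: "prime_divisor Q g" and "P dvd Q"
  shows "P = Q"
proof -
  have "\<not> P dvd 1" using P by (auto simp: prime_divisor_def irreducible_def)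
  with \<open>P dvd Q\<close> Q have "Q dvd P"
    by (auto simp: prime_divisor_def irreducible_altdef)
  have monic: "lead_coeff P = 1" "lead_coeff Q = 1" "P \<noteq> 0" "Q \<noteq> 0"
    using P Q by (auto simp: prime_divisor_def)
  obtain r where r: "Q = P * r" using \<open>P dvd Q\<close> ..
  then have "degree r = 0"
    using dvd_imp_degree_le[OF \<open>Q dvd P\<close>] monic by (auto simp: degree_mult_eq)
  moreover have "lead_coeff r = 1" using monic(1,2) by (simp add: r lead_coeff_mult)
  ultimately have "r = 1" by (metis degree_0_id lead_coeff_pCons(2) one_pCons)
  then show ?thesis using r by simp
qed

text \<open>The factor \<open>a\<close> is the full power of \<open>P\<close> in \<open>f\<close>.
  The cofactor is not a unit, since otherwise \<open>Q\<close> would divide a power of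
  \<open>P\<close> and so equal \<open>P\<close>.\<close>

lemma coprime_decomposition:
  fixes f :: "'a :: field poly"
  assumes "f \<noteq> 0" "prime_divisor P f" "prime_divisor Q f" "P \<noteq> Q"
  obtains a b where "f = a * b" "coprime a b" "\<not> a dvd 1" "\<not> b dvd 1"
proof -
  have irr: "irreducible P" "irreducible Q" "P dvd f" "Q dvd f"
    using assms by (auto simp: prime_divisor_def)
  then have nu: "\<not> P dvd 1" "\<not> Q dvd 1" "P \<noteq> 0" by (auto simp: irreducible_def)
  then have "degree P > 0" by (simp add: is_unit_iff_degree)
  \<comment> \<open>This bound on the exponents guarantees a largest one.\<close>
  have "n \<le> degree f" if "P ^ n dvd f" for n
  proof -
    have "n * 1 \<le> n * degree P" using \<open>degree P > 0\<close> by (intro mult_le_mono2) simp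
    also have "\<dots> \<le> degree f"
      using dvd_imp_degree_le[OF that assms(1)] by (simp add: degree_power_eq \<open>P \<noteq> 0\<close>)
    finally show ?thesis by simp
  qed
  then obtain k where k: "P ^ k dvd f" "\<And>n. P ^ n dvd f \<Longrightarrow> n \<le> k"
    using ex_has_greatest_nat[of "\<lambda>n. P ^ n dvd f" 0 "\<lambda>n. n" "Suc (degree f)"] by (auto simp: less_Suc_eq_le)
  then obtain b where b: "f = P ^ k * b" by blast
  have "\<not> P dvd b"
  proof
    assume "P dvd b"
    then have "P ^ Suc k dvd f" unfolding b power_Suc2 by (intro mult_dvd_mono) auto
    with k(2) show False by fastforce
  qed
  note b = b this
  have "b \<noteq> 0" using b assms(1) by auto
  have "k \<noteq> 0" using b irr by (intro notI) auto
  have eq_P: "R = P" if "prime_divisor R (P ^ k)" for R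
  proof -
    have "prime_elem R"
      using that field_poly_irreducible_imp_prime by (auto simp: prime_divisor_def)
    then have "R dvd P"
      using that prime_elem_dvd_power by (auto simp: prime_divisor_def)
    then show ?thesis using prime_divisor_dvd_eq that assms(2) by blast
  qed
  have "coprime (P ^ k) b"
    using eq_P b nu by (intro coprime_polyI) (auto simp: prime_divisor_def)
  moreover have "\<not> P ^ k dvd 1"
    using nu \<open>k \<noteq> 0\<close> by (simp add: is_unit_power_iff)
  moreover have "\<not> b dvd 1"
  proof
    assume "b dvd 1"
    then have "prime_divisor Q (P ^ k)"
      using b assms(3) by (auto simp: prime_divisor_def dvd_mult_unit_iff)
    then show False using eq_P assms(4) by blast
  qed
  ultimately show ?thesis using b that by blast
qed

section \<open>Reduced residues and the characteristic\<close>

lemma not_is_unit_if_degree_ge_1: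
  fixes f :: "'a :: field poly"
  assumes "degree f \<ge> 1"
  shows "\<not> f dvd 1"
  using assms by (cases "f = 0") (auto simp: is_unit_iff_degree)

lemma degree_mod_less_degree_ge_1:
  fixes f g :: "'a :: field poly"
  assumes "degree f \<ge> 1"
  shows "degree (g mod f) < degree f"
  using assms degree_mod_less[of f g] by (cases "f = 0") auto

lemma poly_eq_if_cong_degree_less:
  fixes f g h :: "'a :: field poly"
  assumes "[g = h] (mod f)" "degree g < degree f" "degree h < degree f"
  shows "g = h"
  using assms by (simp add: cong_def mod_poly_less)

text \<open>If 2 vanished, the characteristic would be 2, and it divides the order of the
  field.\<close>

lemma two_neq_zero_if_odd_card:
  assumes "odd CARD('a :: {field, finite})"
  shows "(2 :: 'a) \<noteq> 0"
proof
  assume two: "(2 :: 'a) = 0"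
  then have "of_nat 2 = (0 :: 'a)" by simp
  then have "CHAR('a) dvd 2" by (simp only: of_nat_eq_0_iff_char_dvd)
  moreover have "CHAR('a) dvd CARD('a)" by (rule CHAR_dvd_CARD)
  moreover have "CHAR('a) \<noteq> 1" by simp
  ultimately show False using assms by (metis dvd_trans prime_nat_iff two_is_prime_nat)
qed

section \<open>Reduction to the square roots of 1 modulo \<open>f\<close>\<close>

text \<open>The 2-torsion of the unit group modulo \<open>f\<close>; the degree bound selects one
  representative of each class.\<close>

definition square_roots_of_unity :: "'a :: field poly \<Rightarrow> 'a poly set" where
  "square_roots_of_unity f = {g. degree g < degree f \<and> [g * g = 1] (mod f)}"

text \<open>For nonconstant \<open>f\<close>, zero is not coprime to \<open>f\<close>, so the
  condition \<open>g \<noteq> 0\<close> is absorbed by invertibility.\<close>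

lemma gauss_factorial_support_eq:
  fixes f :: "'a :: field poly"
  assumes "degree f \<ge> 1"
  shows "gauss_factorial_support f = {g. degree g < degree f \<and> (\<exists>h. [g * h = 1] (mod f))}"
proof -
  have "\<not> coprime 0 f"
    using not_is_unit_if_degree_ge_1[OF assms] by simp
  then show ?thesis
    unfolding gauss_factorial_support_def coprime_iff_cong_inverse[symmetric] by auto
qed

lemma square_roots_of_unity_subset:
  assumes "degree f \<ge> 1"
  shows "square_roots_of_unity f \<subseteq> gauss_factorial_support f"
  using assms by (auto simp: square_roots_of_unity_def gauss_factorial_support_eq)

lemma gauss_factorial_cong_square_roots:
  fixes f :: "'a :: {field, finite} poly"
  assumes f: "degree f \<ge> 1"
  shows "[gauss_factorial f = \<Prod>(square_roots_of_unity f)] (mod f)"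
proof -
  let ?U = "gauss_factorial_support f" and ?S = "square_roots_of_unity f"
  have fin: "finite ?U" by (rule finite_gauss_factorial_support)
  have "[\<Prod>(?U - ?S) = 1 ^ (card (?U - ?S) div 2)] (mod f)"
  proof (rule cong_prod_pairing)
    show "\<not> [x * x = 1] (mod f)" if "x \<in> ?U - ?S" for x
      using that by (auto simp: square_roots_of_unity_def gauss_factorial_support_def)
  next
    fix x assume x: "x \<in> ?U - ?S"
    then obtain h where h: "[x * h = 1] (mod f)" and dx: "degree x < degree f"
      by (auto simp: gauss_factorial_support_eq[OF f])
    define y where "y = h mod f"
    have xy: "[x * y = 1] (mod f)"
      using h by (simp add: y_def cong_def mod_mult_right_eq)
    have dy: "degree y < degree f"
      unfolding y_def by (rule degree_mod_less_degree_ge_1[OF f])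
    \<comment> \<open>Modulo \<open>f\<close>, \<open>z = z * (x * y) = y * (x * z) = y\<close>, and
      both are reduced.\<close>
    have uniq: "z = y" if "degree z < degree f" "[x * z = 1] (mod f)" for z
    proof -
      have "[z * (x * y) = y * (x * z)] (mod f)" by (simp add: ac_simps)
      moreover have "[z * (x * y) = z * 1] (mod f)" "[y * (x * z) = y * 1] (mod f)"
        using cong_scalar_left[OF xy] cong_scalar_left[OF that(2)] by blast+
      ultimately have "[z = y] (mod f)"
        by (metis cong_sym cong_trans mult_1_right)
      then show ?thesis using dy that poly_eq_if_cong_degree_less by blast
    qed
    have "y \<in> ?U"
      using xy dy by (auto simp: gauss_factorial_support_eq[OF f] mult.commute)
    \<comment> \<open>If \<open>y\<close> were its own inverse, then
      \<open>x = x * (y * y) = y * (x * y) = y\<close> modulo \<open>f\<close>, which would put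
      \<open>x\<close> in \<open>?S\<close>.\<close>
    moreover have "y \<notin> ?S"
    proof
      assume "y \<in> ?S"
      then have yy: "[y * y = 1] (mod f)" by (simp add: square_roots_of_unity_def)
      have "[x * (y * y) = y * (x * y)] (mod f)" by (simp add: ac_simps)
      moreover have "[x * (y * y) = x * 1] (mod f)" "[y * (x * y) = y * 1] (mod f)"
        using cong_scalar_left[OF xy] cong_scalar_left[OF yy] by blast+
      ultimately have "[x = y] (mod f)"
        by (metis cong_sym cong_trans mult_1_right)
      then have "x = y" using dx dy poly_eq_if_cong_degree_less by blast
      with \<open>y \<in> ?S\<close> x show False by simp
    qed
    ultimately show "\<exists>!y. y \<in> ?U - ?S \<and> [x * y = 1] (mod f)"
      using xy uniq by (intro ex1I[of _ y]) (auto simp: gauss_factorial_support_def)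
  qed (use fin in auto)
  then have "[\<Prod>(?U - ?S) * \<Prod>?S = 1 * \<Prod>?S] (mod f)"
    by (intro cong_scalar_right) simp
  moreover have "\<Prod>(?U - ?S) * \<Prod>?S = gauss_factorial f"
    unfolding gauss_factorial_def
    using prod.subset_diff[OF square_roots_of_unity_subset[OF f] fin] by metis
  ultimately show ?thesis by simp
qed

text \<open>The partner of \<open>x\<close> is the residue of \<open>c * x\<close>, because
  \<open>x * (c * x) = c\<close> modulo \<open>f\<close>; as \<open>x * x = 1\<close> and
  \<open>c\<close> is not 1, no \<open>x\<close> is its own partner. The argument is used both for
  \<open>c = - 1\<close> and for a nontrivial root.\<close>

lemma prod_square_roots_of_unity_cong:
  fixes f c :: "'a :: {field, finite} poly"
  assumes f: "degree f \<ge> 1" and c: "[c * c = 1] (mod f)" "\<not> [c = 1] (mod f)"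
  shows "[\<Prod>(square_roots_of_unity f) = c ^ (card (square_roots_of_unity f) div 2)] (mod f)"
proof (rule cong_prod_pairing)
  let ?S = "square_roots_of_unity f"
  show "finite ?S"
    using finite_subset[OF square_roots_of_unity_subset[OF f] finite_gauss_factorial_support] .
  fix x assume "x \<in> ?S"
  then have x: "degree x < degree f" "[x * x = 1] (mod f)"
    by (auto simp: square_roots_of_unity_def)
  then show "\<not> [x * x = c] (mod f)"
    using c(2) by (metis cong_sym cong_trans)
  define y where "y = (c * x) mod f"
  have cy: "[y = c * x] (mod f)" by (simp add: y_def)
  have dy: "degree y < degree f"
    unfolding y_def by (rule degree_mod_less_degree_ge_1[OF f])
  have "[y * y = (c * x) * (c * x)] (mod f)" using cy by (intro cong_mult)
  also have "(c * x) * (c * x) = (c * c) * (x * x)" by (simp add: ac_simps)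
  also have "[\<dots> = 1 * 1] (mod f)" using c x by (intro cong_mult)
  finally have "y \<in> ?S" using dy by (simp add: square_roots_of_unity_def)
  moreover have "[x * y = c] (mod f)"
  proof -
    have "[x * y = x * (c * x)] (mod f)" using cy by (rule cong_scalar_left)
    also have "x * (c * x) = c * (x * x)" by (simp add: ac_simps)
    also have "[\<dots> = c * 1] (mod f)" using x by (intro cong_scalar_left)
    finally show ?thesis by simp
  qed
  moreover have "z = y" if z: "z \<in> ?S" "[x * z = c] (mod f)" for z
  proof -
    have "[(x * x) * z = 1 * z] (mod f)" using x by (intro cong_scalar_right)
    moreover have "[x * (x * z) = x * c] (mod f)" using z by (intro cong_scalar_left)
    ultimately have "[z = c * x] (mod f)"
      by (metis cong_sym cong_trans mult.assoc mult.commute mult_1)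
    with cy have "[z = y] (mod f)" by (metis cong_sym cong_trans)
    then show ?thesis
      using z dy by (intro poly_eq_if_cong_degree_less) (auto simp: square_roots_of_unity_def)
  qed
  ultimately show "\<exists>!y. y \<in> ?S \<and> [x * y = c] (mod f)" by blast
qed

section \<open>Trivial and nontrivial square roots of 1\<close>

lemma square_roots_of_unity_unique_prime_divisor:
  fixes f :: "'a :: field poly"
  assumes f: "degree f \<ge> 1" and two: "(2 :: 'a) \<noteq> 0" and ex1: "\<exists>!P. prime_divisor P f"
  shows "square_roots_of_unity f = {1, - 1}"
proof
  show "{1, - 1} \<subseteq> square_roots_of_unity f"
    using f by (auto simp: square_roots_of_unity_def)
  obtain P where P: "prime_divisor P f" "\<And>Q. prime_divisor Q f \<Longrightarrow> Q = P"
    using ex1 by blast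
  have "f \<noteq> 0" using f by auto
  have cop: "coprime h f" if "\<not> P dvd h" for h
    using that P(2) \<open>f \<noteq> 0\<close> coprime_polyI[of f h]
    by (auto simp: prime_divisor_def coprime_commute)
  show "square_roots_of_unity f \<subseteq> {1, - 1}"
  proof
    fix g assume "g \<in> square_roots_of_unity f"
    then have g: "degree g < degree f" "f dvd (g - 1) * (g + 1)"
      by (auto simp: square_roots_of_unity_def cong_iff_dvd_diff algebra_simps)
    have "\<not> (P dvd g - 1 \<and> P dvd g + 1)"
    proof
      assume "P dvd g - 1 \<and> P dvd g + 1"
      then have "P dvd (g + 1) - (g - 1)" by (blast intro: dvd_diff)
      moreover have "(g + 1) - (g - 1) = 2" by simp
      ultimately have "P dvd 2" by simp
      moreover have "(2 :: 'a poly) dvd 1"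
        using two by (simp add: is_unit_const_poly_iff numeral_poly dvd_field_iff)
      ultimately have "P dvd 1" by (rule dvd_trans)
      then show False using P(1) by (auto simp: prime_divisor_def irreducible_def)
    qed
    \<comment> \<open>\<open>P\<close> misses one of the two factors; that factor is coprime to
      \<open>f\<close>, so \<open>f\<close> divides the other.\<close>
    then have "f dvd g + 1 \<or> f dvd g - 1"
      using cop[of "g - 1"] cop[of "g + 1"] g(2) coprime_dvd_multD by (metis mult.commute)
    then have "[g = - 1] (mod f) \<or> [g = 1] (mod f)"
      by (auto simp: cong_iff_dvd_diff)
    then show "g \<in> {1, - 1}"
      using g(1) f poly_eq_if_cong_degree_less[of g _ f] by auto
  qed
qed

text \<open>Chinese remaindering: \<open>u\<close> is 1 modulo \<open>a\<close> and -1 modulo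
  \<open>b\<close>.\<close>

lemma nontrivial_square_root_of_unity:
  fixes f a b :: "'a :: field poly"
  assumes two: "(2 :: 'a) \<noteq> 0"
    and f: "f = a * b" and "coprime a b" "\<not> a dvd 1" "\<not> b dvd 1"
  obtains u where "[u * u = 1] (mod f)" "\<not> [u = 1] (mod f)" "\<not> [u = - 1] (mod f)"
proof -
  obtain x y where xy: "a * x + b * y = 1"
    using coprime_imp_bezout \<open>coprime a b\<close> .
  define u where "u = 1 - 2 * (a * x)"
  have u1: "u - 1 = a * (- 2 * x)" by (simp add: u_def)
  have "u + 1 = 2 * (a * x + b * y) - 2 * (a * x)" unfolding xy by (simp add: u_def)
  then have u2: "u + 1 = b * (2 * y)" by (simp add: algebra_simps)
  have u3: "(u + 1) - (u - 1) = 2" by simp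
  have two': "(2 :: 'a poly) dvd 1"
    using two by (simp add: is_unit_const_poly_iff numeral_poly dvd_field_iff)
  \<comment> \<open>A common divisor divides the unit 2. Hence \<open>b\<close> cannot divide
    \<open>u - 1\<close> as well as \<open>u + 1\<close>, nor \<open>a\<close> divide
    \<open>u + 1\<close> as well as \<open>u - 1\<close>.\<close>
  have unit: "c dvd 1" if "c dvd u - 1" "c dvd u + 1" for c
    using dvd_diff[OF that(2,1)] two' unfolding u3 by (rule dvd_trans)
  have "u * u - 1 = (u - 1) * (u + 1)" by (simp add: algebra_simps)
  also have "f dvd \<dots>" unfolding f u1 u2 by (intro mult_dvd_mono) auto
  finally have "[u * u = 1] (mod f)" by (simp add: cong_iff_dvd_diff)
  moreover have "\<not> [u = 1] (mod f)"
  proof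
    assume "[u = 1] (mod f)"
    then have "b dvd u - 1" using f by (auto simp: cong_iff_dvd_diff dest: dvd_mult_right)
    then show False using unit[of b] u2 assms by auto
  qed
  moreover have "\<not> [u = - 1] (mod f)"
  proof
    assume "[u = - 1] (mod f)"
    then have "a dvd u + 1" using f by (auto simp: cong_iff_dvd_diff dest: dvd_mult_left)
    then show False using unit[of a] u1 assms by auto
  qed
  ultimately show ?thesis by (rule that)
qed

theorem theorem3p1:
  fixes p s :: nat and f :: "'a :: finite_field poly"
  assumes "prime p" and "odd p" and "s \<ge> 1"
    and "CARD('a) = p ^ s"
    and "degree f \<ge> 1"
  shows "[gauss_factorial f = (if \<exists>!P. prime_divisor P f then - 1 else 1)] (mod f)"
proof -
  have two: "(2 :: 'a) \<noteq> 0"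
    using assms by (intro two_neq_zero_if_odd_card) simp
  have two': "(2 :: 'a poly) dvd 1"
    using two by (simp add: is_unit_const_poly_iff numeral_poly dvd_field_iff)
  have f: "f \<noteq> 0" "\<not> f dvd 1"
    using assms(5) not_is_unit_if_degree_ge_1 by auto
  have neq: "\<not> [- 1 = 1] (mod f)"
  proof
    assume "[- 1 = 1] (mod f)"
    then have "f dvd - 2" by (simp add: cong_iff_dvd_diff)
    then have "f dvd 2" by simp
    then show False using two' f(2) dvd_trans by blast
  qed
  have "[\<Prod>(square_roots_of_unity f) = (if \<exists>!P. prime_divisor P f then - 1 else 1)] (mod f)"
  proof (cases "\<exists>!P. prime_divisor P f")
    case True
    \<comment> \<open>Ensures that \<open>{1, - 1}\<close> has two elements, so that its product is
      -1.\<close>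
    have "(- 1 :: 'a poly) \<noteq> 1" using neq by (metis cong_refl)
    then show ?thesis
      using True square_roots_of_unity_unique_prime_divisor[OF assms(5) two True] by simp
  next
    case False
    obtain P where "prime_divisor P f" using monic_irreducible_divisor_exists f .
    \<comment> \<open>A prime divisor exists because \<open>f\<close> is nonconstant, so failure of
      \<open>\<exists>!\<close> means a second one.\<close>
    moreover from this obtain Q where "prime_divisor Q f" "P \<noteq> Q" using False by blast
    ultimately obtain a b where "f = a * b" "coprime a b" "\<not> a dvd 1" "\<not> b dvd 1"
      using coprime_decomposition f(1) by metis
    then obtain u where u: "[u * u = 1] (mod f)" "\<not> [u = 1] (mod f)" "\<not> [u = - 1] (mod f)"
      using nontrivial_square_root_of_unity two by metis
    define k where "k = card (square_roots_of_unity f) div 2"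
    have m: "[\<Prod>(square_roots_of_unity f) = (- 1) ^ k] (mod f)"
      using prod_square_roots_of_unity_cong[OF assms(5), of "- 1"] neq by (simp add: k_def)
    have "even k"
    \<comment> \<open>For odd \<open>k\<close>, the same product would be congruent to both
      \<open>u ^ k = u\<close> and \<open>(- 1) ^ k = - 1\<close>.\<close>
    proof (rule ccontr)
      assume "odd k"
      then obtain j where j: "k = Suc (2 * j)" by (auto elim: oddE)
      have "[u * (u * u) ^ j = u * 1 ^ j] (mod f)"
        using u(1) by (intro cong_scalar_left cong_pow)
      moreover have "u ^ k = u * (u * u) ^ j"
        by (simp add: j power_mult power2_eq_square)
      moreover have "[\<Prod>(square_roots_of_unity f) = u ^ k] (mod f)"
        unfolding k_def using u by (intro prod_square_roots_of_unity_cong assms(5))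
      ultimately have "[u = - 1] (mod f)"
        using m \<open>odd k\<close> by (simp add: cong_def)
      with u(3) show False by simp
    qed
    with m False show ?thesis by simp
  qed
  with gauss_factorial_cong_square_roots[OF assms(5)] show ?thesis
    by (rule cong_trans)
qed

end
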